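(* Let $G$ be a finite group whose derived subgroup $G'$ is nilpotent. Then $\mathrm{MaxDim}(G)=m(G)$.
   Context: For a finite group $G$, a finite sequence $(g_1,\dots,g_n)$ of elements of $G$ is irredundant if for every $i\in\{1,\dots,n\}$ the subgroup $\langle g_j \mid j\neq i\rangle$ is properly contained in $\langle g_1,\dots,g_n\rangle$. $m(G)$ denotes the maximum size $n$ of an irredundant generating sequence of $G$, i.e. an irredundant sequence with $\langle g_1,\dots,g_n\rangle=G$. A family of subgroups $(H_i)_{i\in I}$ of $G$ is in general position if for every $i\in I$ the intersection $\bigcap_{j\neq i}H_j$ properly contains $\bigcap_{j\in I}H_j$ (the empty intersection is $G$). $\mathrm{MaxDim}(G)$ denotes the size of the largest family of maximal subgroups of $G$ in general position. *)

theory Defs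
  imports "HOL-Algebra.Algebra"
begin

section \<open>Irredundant sequences\<close>

definition irredundant :: "('a, 'b) monoid_scheme \<Rightarrow> 'a list \<Rightarrow> bool" where
  "irredundant G gs \<longleftrightarrow>
     (\<forall>i < length gs. generate G {gs ! j | j. j < length gs \<and> j \<noteq> i} \<subset> generate G (set gs))"

definition irredundant_generating :: "('a, 'b) monoid_scheme \<Rightarrow> 'a list \<Rightarrow> bool" where
  "irredundant_generating G gs \<longleftrightarrow>
     set gs \<subseteq> carrier G \<and> irredundant G gs \<and> generate G (set gs) = carrier G"

text \<open>For finite groups, the maximum below ranges over a finite nonempty set; see
  \<open>finite_irredundant_generating_lengths\<close> and \<open>irredundant_generating_exists\<close>. The empty
  sequence is allowed, so the trivial group has value 0.\<close>

definition m_irr :: "('a, 'b) monoid_scheme \<Rightarrow> nat" where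
  "m_irr G = Max {length gs | gs. irredundant_generating G gs}"

section \<open>Maximal subgroups in general position\<close>

definition maximal_subgroup :: "'a set \<Rightarrow> ('a, 'b) monoid_scheme \<Rightarrow> bool" where
  "maximal_subgroup M G \<longleftrightarrow>
     subgroup M G \<and> M \<noteq> carrier G \<and>
     (\<forall>K. subgroup K G \<longrightarrow> M \<subseteq> K \<longrightarrow> K = M \<or> K = carrier G)"

text \<open>Intersecting with the carrier only matters for empty intersections, which are the whole
  group rather than \<^const>\<open>UNIV\<close>.\<close>

definition general_position :: "('a, 'b) monoid_scheme \<Rightarrow> 'i set \<Rightarrow> ('i \<Rightarrow> 'a set) \<Rightarrow> bool" where
  "general_position G I H \<longleftrightarrow>
     (\<forall>i\<in>I. carrier G \<inter> (\<Inter>j\<in>I. H j) \<subset> carrier G \<inter> (\<Inter>j\<in>I - {i}. H j))"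

text \<open>A family in general position has pairwise distinct members, so in a finite group it is
  finite and can be indexed by an initial segment of the natural numbers; see
  \<open>finite_general_position_sizes\<close>. The empty family is allowed (\<open>general_position_empty\<close>).\<close>

definition max_dim :: "('a, 'b) monoid_scheme \<Rightarrow> nat" where
  "max_dim G = Max {n. \<exists>H :: nat \<Rightarrow> 'a set.
     (\<forall>i<n. maximal_subgroup (H i) G) \<and> general_position G {..<n} H}"

section \<open>Nilpotent groups\<close>

definition commutator_subgroup :: "('a, 'b) monoid_scheme \<Rightarrow> 'a set \<Rightarrow> 'a set \<Rightarrow> 'a set" where
  "commutator_subgroup G H K =
     generate G (\<Union>h\<in>H. \<Union>k\<in>K. {h \<otimes>\<^bsub>G\<^esub> k \<otimes>\<^bsub>G\<^esub> inv\<^bsub>G\<^esub> h \<otimes>\<^bsub>G\<^esub> inv\<^bsub>G\<^esub> k})"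

lemma commutator_subgroup_self: "commutator_subgroup G H H = derived G H"
  by (simp add: commutator_subgroup_def derived_def)

fun lower_central :: "('a, 'b) monoid_scheme \<Rightarrow> nat \<Rightarrow> 'a set" where
  "lower_central G 0 = carrier G"
| "lower_central G (Suc n) = commutator_subgroup G (lower_central G n) (carrier G)"

definition nilpotent_group :: "('a, 'b) monoid_scheme \<Rightarrow> bool" where
  "nilpotent_group G \<longleftrightarrow> group G \<and> (\<exists>n. lower_central G n = {\<one>\<^bsub>G\<^esub>})"

section \<open>The two maxima are well defined\<close>

lemma irredundant_distinct:
  assumes "irredundant G gs" shows "distinct gs"
proof (rule ccontr)
  assume "\<not> distinct gs"
  then obtain i k where ik: "i < length gs" "k < length gs" "i \<noteq> k" "gs ! i = gs ! k"
    by (auto simp: distinct_conv_nth)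
  have "set gs \<subseteq> {gs ! j | j. j < length gs \<and> j \<noteq> i}"
  proof
    fix x assume "x \<in> set gs"
    then obtain j where j: "j < length gs" "x = gs ! j" by (auto simp: in_set_conv_nth)
    show "x \<in> {gs ! j | j. j < length gs \<and> j \<noteq> i}"
      using j ik by (cases "j = i") auto
  qed
  then have "{gs ! j | j. j < length gs \<and> j \<noteq> i} = set gs" by auto
  then show False using assms ik(1) unfolding irredundant_def by auto
qed

lemma finite_irredundant_generating_lengths:
  assumes "finite (carrier G)"
  shows "finite {length gs | gs. irredundant_generating G gs}"
proof (rule finite_subset)
  show "{length gs | gs. irredundant_generating G gs} \<subseteq> {..card (carrier G)}"
  proof clarsimp
    fix gs assume "irredundant_generating G gs"
    then have "distinct gs" "set gs \<subseteq> carrier G"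
      by (auto simp: irredundant_generating_def irredundant_distinct)
    then show "length gs \<le> card (carrier G)"
      using card_mono[OF assms] by (metis distinct_card)
  qed
qed simp

lemma (in group) irredundant_generating_exists:
  assumes "finite (carrier G)"
  shows "\<exists>gs. irredundant_generating G gs"
proof -
  let ?P = "\<lambda>gs. set gs \<subseteq> carrier G \<and> generate G (set gs) = carrier G"
  obtain xs where xs: "set xs = carrier G" using finite_list[OF assms] by blast
  have "generate G (carrier G) = carrier G"
    using generate_incl[of "carrier G"] generate.incl[of _ "carrier G" G] by blast
  then have "?P xs" unfolding xs by simp
  then obtain gs where gs: "?P gs" and min: "\<And>ys. ?P ys \<Longrightarrow> length gs \<le> length ys"
    using ex_has_least_nat[of ?P xs length] by blast
  have "generate G {gs ! j | j. j < length gs \<and> j \<noteq> i} \<subset> generate G (set gs)"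
    if i: "i < length gs" for i
  proof
    let ?S = "{gs ! j | j. j < length gs \<and> j \<noteq> i}"
    have S: "?S \<subseteq> set gs" by auto
    show "generate G ?S \<subseteq> generate G (set gs)" using S by (rule mono_generate)
    let ?ys = "map ((!) gs) (filter (\<lambda>j. j \<noteq> i) [0..<length gs])"
    have ys: "set ?ys = ?S" by auto
    have len: "length ?ys < length gs"
      using length_filter_less[of i "[0..<length gs]" "\<lambda>j. j \<noteq> i"] i by auto
    show "generate G ?S \<noteq> generate G (set gs)"
    proof
      assume eq: "generate G ?S = generate G (set gs)"
      have "?P ?ys" unfolding ys eq using subset_trans[OF S] gs by (intro conjI) simp_all
      then show False using min[of ?ys] len by simp
    qed
  qed
  then have "irredundant_generating G gs"
    using gs by (auto simp: irredundant_generating_def irredundant_def)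
  then show ?thesis by blast
qed

lemma general_position_inj_on:
  assumes "general_position G I H" shows "inj_on H I"
proof (rule inj_onI, rule ccontr)
  fix i k assume ik: "i \<in> I" "k \<in> I" "H i = H k" "i \<noteq> k"
  then have "(\<Inter>j\<in>I - {i}. H j) \<subseteq> (\<Inter>j\<in>I. H j)" by blast
  then have "carrier G \<inter> (\<Inter>j\<in>I - {i}. H j) \<subseteq> carrier G \<inter> (\<Inter>j\<in>I. H j)"
    by (intro Int_mono subset_refl)
  moreover have "carrier G \<inter> (\<Inter>j\<in>I. H j) \<subset> carrier G \<inter> (\<Inter>j\<in>I - {i}. H j)"
    using assms ik(1) unfolding general_position_def by (rule bspec)
  ultimately show False by (meson leD)
qed

lemma finite_general_position_sizes:
  fixes G :: "('a, 'b) monoid_scheme"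
  assumes "finite (carrier G)"
  shows "finite {n. \<exists>H :: nat \<Rightarrow> 'a set.
    (\<forall>i<n. maximal_subgroup (H i) G) \<and> general_position G {..<n} H}"
proof (rule finite_subset)
  show "{n. \<exists>H :: nat \<Rightarrow> 'a set. (\<forall>i<n. maximal_subgroup (H i) G) \<and> general_position G {..<n} H}
    \<subseteq> {..card (Pow (carrier G))}"
  proof
    fix n
    assume "n \<in> {n. \<exists>H :: nat \<Rightarrow> 'a set.
      (\<forall>i<n. maximal_subgroup (H i) G) \<and> general_position G {..<n} H}"
    then obtain H :: "nat \<Rightarrow> 'a set" where
      max: "\<forall>i<n. maximal_subgroup (H i) G" and gp: "general_position G {..<n} H"
      by blast
    have "H ` {..<n} \<subseteq> Pow (carrier G)"
      using max unfolding maximal_subgroup_def by (meson PowI image_subsetI lessThan_iff subgroup.subset)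
    then have "card {..<n} \<le> card (Pow (carrier G))"
      using card_inj_on_le[OF general_position_inj_on[OF gp]] assms by simp
    then show "n \<in> {..card (Pow (carrier G))}" by simp
  qed
qed simp

lemma general_position_empty: "general_position G {} H"
  by (simp add: general_position_def)

end

(*
Write A = G'. The inequality m(G) <= MaxDim(G) holds in every finite group: extend the subgroup
generated by all members but g_i of an irredundant generating sequence to a maximal subgroup M_i.

Conversely let (M_i), i in I, be maximal subgroups in general position. As A is nilpotent, M \<inter> A is
normal in G for each maximal subgroup M. Choose J minimal in I such that A \<inter> \<Inter>(M_j, j in J) is
the intersection R of A with all the M_i, and pick a_i, for i in J, in A and in each M_j with
j in J - {i}, but outside M_i. Put C = \<Inter>(M_j, j in J); then CA = G and C \<inter> A = R. For i in I - J
pick z_i outside M_i but in all other M_j; then z_i lies in C, and since C \<inter> A lies in M_i, these z_i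
are irredundant modulo A. In the abelian group G/A an irredundant set can be exchanged for an
irredundant generating set that is at least as large, here with representatives Y in C. Finally Y
together with the a_i generates G modulo R, irredundantly, and this lifts to an irredundant
generating sequence of G because any minimal generating subset of Y, the a_i and R contains Y and
all a_i.
*)
theory Submission
  imports Defs
begin

context group
begin

section \<open>Products with normal subgroups and maximal overgroups\<close>

lemma generate_Un_normalE:
  assumes "subgroup H G" "N \<lhd> G" "x \<in> generate G (H \<union> N)"
  obtains h n where "h \<in> H" "n \<in> N" "x = h \<otimes> n"
proof -
  interpret N: normal N G by fact
  have HN: "subgroup (N <#> H) G"
    using mult_norm_subgroup[OF assms(2,1)] .
  have eq: "N <#> H = H <#> N"
    using commut_normal[OF assms(1,2)] by simp
  have "H \<union> N \<subseteq> N <#> H"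
  proof
    fix x assume x: "x \<in> H \<union> N"
    then have "x \<in> carrier G" using subgroup.subset[OF assms(1)] N.subset by blast
    then have "x = \<one> \<otimes> x" "x = x \<otimes> \<one>" by simp_all
    then show "x \<in> N <#> H"
      using x subgroup.one_closed[OF assms(1)] N.one_closed unfolding set_mult_def by blast
  qed
  then have "x \<in> H <#> N"
    using generate_subgroup_incl[OF _ HN] assms(3) eq by blast
  then show thesis using that unfolding set_mult_def by blast
qed

text \<open>A conjugate of \<open>h\<close> is a commutator times \<open>h\<close>, and
  \<open>K\<close> contains all commutators.\<close>

lemma normal_of_derived_subset:
  assumes "subgroup K G" "derived G (carrier G) \<subseteq> K"
  shows "K \<lhd> G"
proof (rule normal_invI[OF assms(1)])
  fix x h assume x: "x \<in> carrier G" and h: "h \<in> K"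
  have hG: "h \<in> carrier G" using subgroup.subset[OF assms(1)] h by blast
  have "x \<otimes> h \<otimes> inv x \<otimes> inv h \<in> derived G (carrier G)"
    unfolding derived_def using x hG by (intro generate.incl) blast
  then have "(x \<otimes> h \<otimes> inv x \<otimes> inv h) \<otimes> h \<in> K"
    using assms(2) by (intro subgroup.m_closed[OF assms(1) _ h]) blast
  then show "x \<otimes> h \<otimes> inv x \<in> K" using x hG by (simp add: m_assoc)
qed

lemma maximal_subgroup_exists:
  assumes "finite (carrier G)" "subgroup H G" "H \<noteq> carrier G"
  obtains M where "maximal_subgroup M G" "H \<subseteq> M"
proof -
  let ?F = "{K. subgroup K G \<and> K \<noteq> carrier G}"
  have "?F \<subseteq> Pow (carrier G)" using subgroup.subset by blast
  then have "finite ?F" using assms(1) finite_subset by blast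
  then obtain M where M: "M \<in> ?F" "H \<subseteq> M" "\<forall>K\<in>?F. M \<subseteq> K \<longrightarrow> M = K"
    using finite_has_maximal2[of ?F H] assms(2,3) by auto
  have "K = M \<or> K = carrier G" if "subgroup K G" "M \<subseteq> K" for K
    using M(3) that by auto
  then have "maximal_subgroup M G" using M(1) unfolding maximal_subgroup_def by simp
  then show thesis using that M(2) by simp
qed

section \<open>Irredundant generating sequences and the inequality \<open>m_irr G\<close> \<le>
  \<open>max_dim G\<close>\<close>

text \<open>A minimal generating subset of \<open>Z \<union> N\<close> must contain every
  \<open>z\<close> in \<open>Z\<close>: without \<open>z\<close> it would lie in
  \<open>Z - {z} \<union> N\<close>, which does not generate. So irredundance relative to
  \<open>N\<close> already bounds \<open>m_irr G\<close> from below.\<close>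

lemma le_m_irr:
  assumes "finite (carrier G)" "Z \<subseteq> carrier G" "N \<subseteq> carrier G"
    and gen: "generate G (Z \<union> N) = carrier G"
    and ind: "\<And>z. z \<in> Z \<Longrightarrow> generate G (Z - {z} \<union> N) \<noteq> carrier G"
  shows "card Z \<le> m_irr G"
proof -
  let ?F = "{S. S \<subseteq> Z \<union> N \<and> generate G S = carrier G}"
  have fin: "finite (Z \<union> N)" using assms(1-3) finite_subset by blast
  then have "finite ?F" by simp
  then obtain S where S: "S \<in> ?F" and min: "\<forall>T\<in>?F. T \<subseteq> S \<longrightarrow> S = T"
    using finite_has_minimal2[of ?F "Z \<union> N"] gen by auto
  have SG: "S \<subseteq> carrier G" using S assms(2,3) by blast
  have ZS: "Z \<subseteq> S"
  proof (rule ccontr)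
    assume "\<not> Z \<subseteq> S"
    then obtain z where z: "z \<in> Z" "z \<notin> S" by blast
    then have "S \<subseteq> Z - {z} \<union> N" using S by blast
    then have "carrier G \<subseteq> generate G (Z - {z} \<union> N)" using mono_generate S by blast
    moreover have "generate G (Z - {z} \<union> N) \<subseteq> carrier G"
      using assms(2,3) by (intro generate_incl) blast
    ultimately show False using ind[OF z(1)] by blast
  qed
  have "finite S" using S finite_subset[OF _ fin] by simp
  then obtain gs where gs: "set gs = S" "distinct gs"
    using finite_distinct_list by auto
  have "irredundant G gs"
    unfolding irredundant_def
  proof (intro allI impI)
    fix i assume i: "i < length gs"
    let ?T = "{gs ! j | j. j < length gs \<and> j \<noteq> i}"
    have T: "?T \<subseteq> S" "gs ! i \<in> S" using gs(1) i by (auto dest: nth_mem)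
    have "gs ! i \<notin> ?T" using nth_eq_iff_index_eq[OF gs(2)] i by auto
    then have "?T \<noteq> S" using T(2) by blast
    moreover have "?T \<subseteq> Z \<union> N" using subset_trans[OF T(1)] S by simp
    ultimately have "generate G ?T \<noteq> carrier G" using min T(1) by auto
    then show "generate G ?T \<subset> generate G (set gs)"
      using mono_generate[OF T(1)] gs(1) S by auto
  qed
  then have "irredundant_generating G gs"
    unfolding irredundant_generating_def using gs S SG by auto
  then have "length gs \<in> {length gs | gs. irredundant_generating G gs}" by blast
  then have "length gs \<le> m_irr G"
    unfolding m_irr_def using Max_ge finite_irredundant_generating_lengths[OF assms(1)] by blast
  then show ?thesis
    using card_mono[OF _ ZS] gs distinct_card[OF gs(2)] by auto
qed

text \<open>The generator \<open>gs ! i\<close> witnesses general position at \<open>i\<close>. It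
  lies in every other \<open>H j\<close> by the choice of \<open>H j\<close>, and not in
  \<open>H i\<close>, which would otherwise contain the whole generating sequence.\<close>

lemma m_irr_le_max_dim:
  assumes "finite (carrier G)"
  shows "m_irr G \<le> max_dim G"
proof -
  have "m_irr G \<in> {length gs | gs. irredundant_generating G gs}"
    unfolding m_irr_def using finite_irredundant_generating_lengths[OF assms]
      irredundant_generating_exists[OF assms] by (intro Max_in) auto
  then obtain gs where len: "m_irr G = length gs" and gs: "irredundant_generating G gs" by blast
  let ?n = "length gs"
  let ?T = "\<lambda>i. {gs ! j | j. j < ?n \<and> j \<noteq> i}"
  have G: "set gs \<subseteq> carrier G" "generate G (set gs) = carrier G"
    and irr: "\<And>i. i < ?n \<Longrightarrow> generate G (?T i) \<subset> carrier G"
    using gs unfolding irredundant_generating_def irredundant_def by auto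
  have "\<exists>M. maximal_subgroup M G \<and> generate G (?T i) \<subseteq> M" if "i < ?n" for i
  proof -
    have "?T i \<subseteq> carrier G" using G(1) by (auto dest: nth_mem)
    then have "subgroup (generate G (?T i)) G" by (rule generate_is_subgroup)
    moreover have "generate G (?T i) \<noteq> carrier G" using irr[OF that] by simp
    ultimately obtain M where "maximal_subgroup M G" "generate G (?T i) \<subseteq> M"
      by (rule maximal_subgroup_exists[OF assms])
    then show ?thesis by (intro exI conjI)
  qed
  then have "\<forall>i. \<exists>M. i < ?n \<longrightarrow> maximal_subgroup M G \<and> generate G (?T i) \<subseteq> M" by blast
  then obtain H where H: "\<And>i. i < ?n \<Longrightarrow> maximal_subgroup (H i) G"
    and HT: "\<And>i. i < ?n \<Longrightarrow> generate G (?T i) \<subseteq> H i"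
    unfolding choice_iff by blast
  have mem: "gs ! j \<in> H i" if "i < ?n" "j < ?n" "j \<noteq> i" for i j
  proof -
    have "gs ! j \<in> ?T i" using that by auto
    then show ?thesis using HT[OF that(1)] generate.incl[of "gs ! j" "?T i" G] by auto
  qed
  have nmem: "gs ! i \<notin> H i" if "i < ?n" for i
  proof
    assume "gs ! i \<in> H i"
    then have "gs ! j \<in> H i" if "j < ?n" for j
      using mem[OF \<open>i < ?n\<close> that] by (cases "j = i") simp_all
    then have "set gs \<subseteq> H i" by (auto simp: in_set_conv_nth)
    moreover have sub: "subgroup (H i) G" and ne: "H i \<noteq> carrier G"
      using H[OF that] unfolding maximal_subgroup_def by simp_all
    ultimately have "carrier G \<subseteq> H i"
      using generate_subgroup_incl[of "set gs" "H i"] G(2) by simp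
    then show False using subgroup.subset[OF sub] ne by simp
  qed
  have "general_position G {..<?n} H"
    unfolding general_position_def
  proof
    fix i assume i: "i \<in> {..<?n}"
    then have "gs ! i \<in> carrier G \<inter> (\<Inter>j\<in>{..<?n} - {i}. H j)"
      using mem G(1) by (auto dest: nth_mem)
    moreover have "gs ! i \<notin> carrier G \<inter> (\<Inter>j\<in>{..<?n}. H j)" using nmem i by auto
    ultimately show "carrier G \<inter> (\<Inter>j\<in>{..<?n}. H j) \<subset> carrier G \<inter> (\<Inter>j\<in>{..<?n} - {i}. H j)"
      by blast
  qed
  then have "m_irr G \<in> {n. \<exists>H :: nat \<Rightarrow> 'a set.
      (\<forall>i<n. maximal_subgroup (H i) G) \<and> general_position G {..<n} H}"
    using H len by auto
  then show ?thesis unfolding max_dim_def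
    using Max_ge finite_general_position_sizes[OF assms] by blast
qed

section \<open>Cyclic subgroups whose subgroups form a chain\<close>

text \<open>The minimality of the order of \<open>y\<close> outside \<open>K\<close> forces that order to be a prime power, so that
  the subgroups of the cyclic group generated by \<open>y\<close> form a chain.\<close>

lemma int_pow_cases_of_minimal_ord:
  assumes y: "y \<in> carrier G" and K: "subgroup K G" "y \<notin> K" and fin: "finite (carrier G)"
    and min: "\<And>u. u \<in> generate G {y} \<Longrightarrow> u \<notin> K \<Longrightarrow> ord y \<le> ord u"
  fixes k l :: int
  shows "(\<exists>m::int. y [^] k = (y [^] l) [^] m) \<or> (\<exists>m::int. y [^] l = (y [^] k) [^] m)"
proof -
  let ?n = "int (ord y)"
  have n0: "ord y > 0" using ord_ge_1[OF fin y] by simp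
  \<comment> \<open>For a proper divisor step, \<open>y [^] a\<close> has the smaller order
    \<open>ord y div a\<close>, so minimality of \<open>ord y\<close> puts it into
    \<open>K\<close>.\<close>
  have less: "y [^] a \<in> K" if "a dvd ord y" "a \<noteq> 1" for a :: nat
  proof (rule ccontr)
    assume "y [^] a \<notin> K"
    moreover have "y [^] a \<in> generate G {y}"
      using generate_pow[OF y] int_pow_int[of G y a] by (metis (mono_tags, lifting) UNIV_I mem_Collect_eq)
    ultimately have "ord y \<le> ord (y [^] a)" using min by blast
    moreover have a0: "a \<noteq> 0" using that n0 by auto
    ultimately have "ord y \<le> ord y div a" using ord_pow[OF y that(1)] by simp
    then show False using that a0 n0 by (metis One_nat_def div_less_dividend less_one linorder_neqE_nat not_le)
  qed
  \<comment> \<open>By Bezout, \<open>y\<close> is a product of powers of \<open>y [^] a\<close> and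
    \<open>y [^] b\<close>, so these cannot both lie in \<open>K\<close>. This expresses that
    \<open>ord y\<close> is a prime power without mentioning primes.\<close>
  have cop: "a = 1 \<or> b = 1" if ab: "a dvd ord y" "b dvd ord y" "coprime a b" for a b :: nat
  proof (rule ccontr)
    assume "\<not> (a = 1 \<or> b = 1)"
    then have KK: "y [^] a \<in> K" "y [^] b \<in> K" using less ab by auto
    obtain u v :: int where uv: "u * int a + v * int b = 1"
      using bezout_int[of "int a" "int b"] ab(3) by auto
    have "(y [^] int a) [^] u \<otimes> (y [^] int b) [^] v \<in> K"
      using KK subgroup_int_pow_closed[OF K(1)] subgroup.m_closed[OF K(1)] by (simp add: int_pow_int)
    also have "(y [^] int a) [^] u \<otimes> (y [^] int b) [^] v = y [^] (u * int a + v * int b)"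
      using y by (simp add: int_pow_pow int_pow_mult mult.commute)
    finally show False using uv y K(2) by simp
  qed
  have chain: "d1 dvd d2 \<or> d2 dvd d1" if "d1 dvd ord y" "d2 dvd ord y" for d1 d2 :: nat
  proof -
    let ?g = "gcd d1 d2"
    have g0: "?g \<noteq> 0" using that n0 by auto
    have "coprime (d1 div ?g) (d2 div ?g)" using g0 by (intro div_gcd_coprime) auto
    moreover have "d1 div ?g dvd d1" "d2 div ?g dvd d2"
      by (metis dvd_div_mult_self dvd_triv_left gcd_dvd1, metis dvd_div_mult_self dvd_triv_left gcd_dvd2)
    ultimately have "d1 div ?g = 1 \<or> d2 div ?g = 1" using cop that dvd_trans by blast
    then show ?thesis by (metis dvd_div_mult_self gcd_dvd1 gcd_dvd2 mult_1)
  qed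
  \<comment> \<open>The subgroup generated by \<open>y [^] k\<close> is determined by
    \<open>gcd k ?n\<close>, so divisibility of these gcds means containment of the
    subgroups.\<close>
  have pow: "\<exists>m::int. y [^] l = (y [^] k) [^] m" if "gcd k ?n dvd gcd l ?n" for k l
  proof -
    obtain u v where uv: "u * k + v * ?n = gcd k ?n" using bezout_int by blast
    obtain c where c: "l = gcd k ?n * c" using \<open>gcd k ?n dvd gcd l ?n\<close> by (meson dvdE dvd_trans gcd_dvd1)
    have "l = k * (u * c) + ?n * (v * c)" unfolding c uv[symmetric] by (simp add: algebra_simps)
    then have "?n dvd k * (u * c) - l" by simp
    then have "y [^] l = (y [^] k) [^] (u * c)"
      using y int_pow_eq[OF y] by (simp add: int_pow_pow)
    then show ?thesis by blast
  qed
  have "nat (gcd k ?n) dvd nat (gcd l ?n) \<or> nat (gcd l ?n) dvd nat (gcd k ?n)"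
    by (rule chain) (simp_all add: nat_dvd_iff)
  then have "gcd k ?n dvd gcd l ?n \<or> gcd l ?n dvd gcd k ?n"
    by (simp add: nat_dvd_iff)
  then show ?thesis using pow by blast
qed

subsection \<open>Irredundant sets modulo the derived subgroup\<close>

text \<open>This is the preimage in G of the subgroup of the abelian quotient G/G' generated by the
  image of \<open>S\<close>. Working with preimages keeps representatives and their orders in G and
  avoids cosets.\<close>

definition gen_mod_derived :: "'a set \<Rightarrow> 'a set" where
  "gen_mod_derived S = generate G (S \<union> derived G (carrier G))"

definition irredundant_mod_derived :: "'a set \<Rightarrow> bool" where
  "irredundant_mod_derived S \<longleftrightarrow> (\<forall>x\<in>S. x \<notin> gen_mod_derived (S - {x}))"

lemma derived_subset_carrier: "derived G (carrier G) \<subseteq> carrier G"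
  by (simp add: derived_in_carrier)

lemma gen_mod_derived_subgroup: "S \<subseteq> carrier G \<Longrightarrow> subgroup (gen_mod_derived S) G"
  unfolding gen_mod_derived_def using derived_subset_carrier by (intro generate_is_subgroup) simp

lemma gen_mod_derived_incl: "S \<union> derived G (carrier G) \<subseteq> gen_mod_derived S"
  unfolding gen_mod_derived_def by (auto intro: generate.incl)

lemma gen_mod_derived_normal: "S \<subseteq> carrier G \<Longrightarrow> gen_mod_derived S \<lhd> G"
  using normal_of_derived_subset[OF gen_mod_derived_subgroup] gen_mod_derived_incl by blast

lemma gen_mod_derived_mono: "S \<subseteq> T \<Longrightarrow> gen_mod_derived S \<subseteq> gen_mod_derived T"
  unfolding gen_mod_derived_def by (intro mono_generate) auto

lemma gen_mod_derived_least:
  "subgroup K G \<Longrightarrow> S \<subseteq> K \<Longrightarrow> derived G (carrier G) \<subseteq> K \<Longrightarrow> gen_mod_derived S \<subseteq> K"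
  unfolding gen_mod_derived_def by (intro generate_subgroup_incl) auto

text \<open>Splitting off an explicit power of \<open>y\<close> lets two elements of the span be
  compared through their exponents, as the exchange argument requires.\<close>

lemma gen_mod_derived_insertE:
  assumes "S \<subseteq> carrier G" "y \<in> carrier G" "x \<in> gen_mod_derived (insert y S)"
  obtains k :: int and w where "w \<in> gen_mod_derived S" "x = y [^] k \<otimes> w"
proof -
  have y: "subgroup (generate G {y}) G" using assms(2) by (intro generate_is_subgroup) simp
  have N: "gen_mod_derived S \<lhd> G" using gen_mod_derived_normal[OF assms(1)] .
  have "insert y S \<union> derived G (carrier G) \<subseteq> generate G {y} \<union> gen_mod_derived S"
    using gen_mod_derived_incl[of S] generate.incl[of y "{y}" G] by auto
  then have "x \<in> generate G (generate G {y} \<union> gen_mod_derived S)"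
    using assms(3) mono_generate unfolding gen_mod_derived_def[of "insert y S"] by blast
  then obtain h n where "h \<in> generate G {y}" "n \<in> gen_mod_derived S" "x = h \<otimes> n"
    using generate_Un_normalE[OF y N] by blast
  then show thesis using that generate_pow[OF assms(2)] by auto
qed

text \<open>The new element \<open>y\<close> is not redundant, being outside the span of
  \<open>Y\<close>. If another \<open>v\<close> were, then \<open>v\<close>, and with it
  \<open>x\<close>, would be a power of \<open>y\<close> times an element of the span of
  \<open>Y - {x, v}\<close>. One of the two powers of \<open>y\<close> is a power of the other, so
  one of \<open>x\<close>, \<open>v\<close> would lie in the span of the remaining elements of
  \<open>Y\<close>.\<close>

lemma irredundant_mod_derived_exchange:
  assumes fin: "finite (carrier G)" and Y: "Y \<subseteq> carrier G" "irredundant_mod_derived Y"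
    and y: "y \<in> carrier G" "y \<notin> gen_mod_derived Y"
    and min: "\<And>u. u \<in> generate G {y} \<Longrightarrow> u \<notin> gen_mod_derived Y \<Longrightarrow> ord y \<le> ord u"
    and x: "x \<in> Y" "x \<in> gen_mod_derived (insert y (Y - {x}))"
  shows "irredundant_mod_derived (insert y (Y - {x}))"
  unfolding irredundant_mod_derived_def
proof
  let ?c = gen_mod_derived
  have yY: "y \<notin> Y" using y(2) gen_mod_derived_incl by blast
  fix v assume v: "v \<in> insert y (Y - {x})"
  show "v \<notin> ?c (insert y (Y - {x}) - {v})"
  proof (cases "v = y")
    case True
    have "?c (insert y (Y - {x}) - {v}) \<subseteq> ?c Y"
      unfolding True by (intro gen_mod_derived_mono) auto
    then show ?thesis using y(2) True by blast
  next
    case False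
    then have vY: "v \<in> Y" "v \<noteq> x" using v by auto
    let ?L = "Y - {x, v}"
    have L: "?L \<subseteq> carrier G" using Y(1) by blast
    have sub: "subgroup (?c S) G" if "S \<subseteq> carrier G" for S
      using that by (rule gen_mod_derived_subgroup)
    have eq: "insert y (Y - {x}) - {v} = insert y ?L" using False by auto
    show ?thesis unfolding eq
    proof
      assume *: "v \<in> ?c (insert y ?L)"
      have "insert y (Y - {x}) \<subseteq> ?c (insert y ?L)"
        using * gen_mod_derived_incl[of "insert y ?L"] by blast
      then have "x \<in> ?c (insert y ?L)"
        using x(2) gen_mod_derived_least[OF sub, of "insert y ?L" "insert y (Y - {x})"]
          gen_mod_derived_incl[of "insert y ?L"] L y(1) by blast
      then obtain k w where w: "w \<in> ?c ?L" "x = y [^] (k::int) \<otimes> w"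
        using gen_mod_derived_insertE[OF L y(1)] by blast
      obtain l w' where w': "w' \<in> ?c ?L" "v = y [^] (l::int) \<otimes> w'"
        using gen_mod_derived_insertE[OF L y(1) *] by blast
      \<comment> \<open>Stated for \<open>a\<close> and \<open>b\<close> because \<open>x\<close>
        and \<open>v\<close> take either role, depending on which power of \<open>y\<close> is a
        power of the other.\<close>
      have contra: False
        if "a \<in> Y" "b \<in> Y" "a \<noteq> b" and ab: "?L = Y - {a, b}"
          and a: "u \<in> ?c ?L" "a = y [^] i \<otimes> u" and b: "u' \<in> ?c ?L" "b = y [^] j \<otimes> u'"
          and m: "y [^] i = (y [^] j) [^] m"
        for a b u u' and i j m :: int
      proof -
        let ?K = "?c (Y - {a})"
        have K: "subgroup ?K G" using Y(1) by (intro sub) blast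
        have LK: "?c ?L \<subseteq> ?K" unfolding ab by (intro gen_mod_derived_mono) blast
        have "b \<in> ?K" using gen_mod_derived_incl[of "Y - {a}"] that(2,3) by auto
        moreover have u': "u' \<in> ?K" "u' \<in> carrier G" using LK b(1) subgroup.subset[OF K] by auto
        ultimately have "b \<otimes> inv u' \<in> ?K"
          using subgroup.m_closed[OF K] subgroup.m_inv_closed[OF K] by simp
        also have "b \<otimes> inv u' = y [^] j" using b(2) u' y(1) by (simp add: m_assoc)
        finally have "y [^] i \<in> ?K" unfolding m using subgroup_int_pow_closed[OF K] by blast
        then have "a \<in> ?K" using a LK subgroup.m_closed[OF K] by auto
        then show False using Y(2) that(1) unfolding irredundant_mod_derived_def by blast
      qed
      have "(\<exists>m::int. y [^] k = (y [^] l) [^] m) \<or> (\<exists>m::int. y [^] l = (y [^] k) [^] m)"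
        by (rule int_pow_cases_of_minimal_ord[OF y(1) sub[OF Y(1)] y(2) fin min])
      then show False
      proof
        assume "\<exists>m::int. y [^] k = (y [^] l) [^] m"
        then obtain m :: int where "y [^] k = (y [^] l) [^] m" ..
        from contra[OF x(1) vY(1) vY(2)[symmetric] refl w w' this] show False .
      next
        assume "\<exists>m::int. y [^] l = (y [^] k) [^] m"
        then obtain m :: int where "y [^] l = (y [^] k) [^] m" ..
        from contra[OF vY(1) x(1) vY(2) _ w' w this] show False by (simp add: insert_commute)
      qed
    qed
  qed
qed

text \<open>Take \<open>Y\<close> largest in size, then in span. If the span misses some element of
  \<open>C\<close>, choose such an element \<open>y\<close> of least order. Adding \<open>y\<close>
  must destroy irredundance by maximal size, so some \<open>x\<close> in \<open>Y\<close> becomes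
  redundant; exchanging it for \<open>y\<close> keeps the size but enlarges the span, a
  contradiction.\<close>

lemma irredundant_mod_derived_extend:
  assumes fin: "finite (carrier G)" and C: "subgroup C G" "gen_mod_derived C = carrier G"
    and Z: "Z \<subseteq> C" "irredundant_mod_derived Z"
  obtains Y where "Y \<subseteq> C" "irredundant_mod_derived Y" "card Z \<le> card Y"
    "gen_mod_derived Y = carrier G"
proof -
  let ?c = gen_mod_derived
  let ?F = "{Y. Y \<subseteq> C \<and> irredundant_mod_derived Y}"
  \<comment> \<open>\<open>?f\<close> orders lexicographically by size, then by the order of the generated subgroup.\<close>
  let ?f = "\<lambda>Y. card Y * Suc (card (carrier G)) + card (?c Y)"
  have XG: "C \<subseteq> carrier G" using subgroup.subset[OF C(1)] .
  have finX: "finite C" using XG fin finite_subset by blast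
  then have "finite ?F" by simp
  then have fF: "finite (?f ` ?F)" by (rule finite_imageI)
  then have "Max (?f ` ?F) \<in> ?f ` ?F" using Z by (intro Max_in) auto
  then obtain Y where Y: "Y \<subseteq> C" "irredundant_mod_derived Y" and "?f Y = Max (?f ` ?F)" by auto
  then have max: "?f T \<le> ?f Y" if "T \<subseteq> C" "irredundant_mod_derived T" for T
    using Max_ge[OF fF, of "?f T"] that by auto
  have YG: "Y \<subseteq> carrier G" using Y XG by blast
  have cle: "card (?c S) \<le> card (carrier G)" if "S \<subseteq> carrier G" for S
    using card_mono[OF fin subgroup.subset[OF gen_mod_derived_subgroup[OF that]]] .
  have card_max: "card T \<le> card Y" if "T \<subseteq> C" "irredundant_mod_derived T" for T
  proof (rule ccontr)
    assume "\<not> card T \<le> card Y"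
    then have "Suc (card Y) * Suc (card (carrier G)) \<le> card T * Suc (card (carrier G))"
      by (intro mult_le_mono1) simp
    then show False using max[OF that] cle[OF YG] by simp
  qed
  have "?c Y = carrier G"
  proof (rule ccontr)
    assume ne: "?c Y \<noteq> carrier G"
    have subY: "subgroup (?c Y) G" using gen_mod_derived_subgroup[OF YG] .
    have "\<not> C \<subseteq> ?c Y"
    proof
      assume "C \<subseteq> ?c Y"
      then have "?c C \<subseteq> ?c Y"
        using gen_mod_derived_least[OF subY] gen_mod_derived_incl by blast
      then show False using ne C(2) subgroup.subset[OF subY] by blast
    qed
    then obtain y0 where "y0 \<in> C \<and> y0 \<notin> ?c Y" by blast
    then obtain y where y: "y \<in> C" "y \<notin> ?c Y"
      and min: "\<And>u. u \<in> C \<and> u \<notin> ?c Y \<Longrightarrow> ord y \<le> ord u"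
      using ex_has_least_nat[of "\<lambda>u. u \<in> C \<and> u \<notin> ?c Y" y0 ord] by blast
    have yG: "y \<in> carrier G" using y(1) XG by blast
    \<comment> \<open>Powers of \<open>y\<close> stay in \<open>C\<close>, so minimality of the
      order within \<open>C\<close> is enough for the exchange.\<close>
    have gy: "generate G {y} \<subseteq> C" using generate_subgroup_incl[OF _ C(1)] y(1) by simp
    have yY: "y \<notin> Y" using y(2) gen_mod_derived_incl by blast
    have finY: "finite Y" using Y(1) finX finite_subset by blast
    have "\<not> irredundant_mod_derived (insert y Y)"
      using card_max[of "insert y Y"] Y(1) y(1) yY finY by auto
    then obtain x where x: "x \<in> insert y Y" "x \<in> ?c (insert y Y - {x})"
      unfolding irredundant_mod_derived_def by blast
    have "x \<noteq> y" using x(2) y(2) yY by auto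
    then have xY: "x \<in> Y" "x \<in> ?c (insert y (Y - {x}))"
      using x by (auto simp: insert_Diff_if)
    let ?Y = "insert y (Y - {x})"
    have irr: "irredundant_mod_derived ?Y"
      using irredundant_mod_derived_exchange[OF fin YG Y(2) yG y(2) _ xY] min gy by blast
    have YX: "?Y \<subseteq> C" using Y(1) y(1) by blast
    then have YG': "?Y \<subseteq> carrier G" using XG by blast
    have "card ?Y = card Y" using yY xY finY card_Suc_Diff1[OF finY xY(1)] by simp
    then have "card (?c ?Y) \<le> card (?c Y)" using max[OF YX irr] by simp
    moreover have sub': "subgroup (?c ?Y) G" using gen_mod_derived_subgroup[OF YG'] .
    have "Y \<subseteq> ?c ?Y" using xY(2) gen_mod_derived_incl[of ?Y] by blast
    then have "?c Y \<subseteq> ?c ?Y"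
      using gen_mod_derived_least[OF sub'] gen_mod_derived_incl[of ?Y] by blast
    moreover have "y \<in> ?c ?Y" using gen_mod_derived_incl[of ?Y] by blast
    ultimately have "?c Y \<subset> ?c ?Y" using y(2) by blast
    moreover have "finite (?c ?Y)" using subgroup.subset[OF sub'] fin finite_subset by blast
    ultimately have "card (?c Y) < card (?c ?Y)" using psubset_card_mono by blast
    then show False using \<open>card (?c ?Y) \<le> card (?c Y)\<close> by simp
  qed
  then show thesis using that[OF Y] card_max[OF Z] by simp
qed

subsection \<open>Maximal subgroups and normal nilpotent subgroups\<close>

lemma lower_central_subgroup:
  assumes "subgroup A G"
  shows "subgroup (lower_central (G\<lparr>carrier := A\<rparr>) i) G \<and> lower_central (G\<lparr>carrier := A\<rparr>) i \<subseteq> A"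
proof (induction i)
  case 0
  then show ?case using assms by simp
next
  case (Suc i)
  let ?H = "G\<lparr>carrier := A\<rparr>" and ?\<gamma> = "lower_central (G\<lparr>carrier := A\<rparr>) i"
  let ?C = "\<Union>h\<in>?\<gamma>. \<Union>k\<in>A. {h \<otimes> k \<otimes> inv\<^bsub>?H\<^esub> h \<otimes> inv\<^bsub>?H\<^esub> k}"
  have "?C \<subseteq> A"
  proof
    fix x assume "x \<in> ?C"
    then obtain h k where hk: "h \<in> ?\<gamma>" "k \<in> A"
      and x: "x = h \<otimes> k \<otimes> inv\<^bsub>?H\<^esub> h \<otimes> inv\<^bsub>?H\<^esub> k" by blast
    have h: "h \<in> A" using Suc hk(1) by blast
    show "x \<in> A"
      unfolding x m_inv_consistent[OF assms h] m_inv_consistent[OF assms hk(2)]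
      using h hk(2) subgroup.m_closed[OF assms] subgroup.m_inv_closed[OF assms] by simp
  qed
  moreover have "lower_central ?H (Suc i) = generate G ?C"
    using generate_consistent[OF \<open>?C \<subseteq> A\<close> assms] by (simp add: commutator_subgroup_def)
  moreover have "subgroup (generate G ?C) G"
    using \<open>?C \<subseteq> A\<close> subgroup.subset[OF assms] by (intro generate_is_subgroup) (rule subset_trans)
  ultimately show ?case
    using generate_subgroup_incl[OF \<open>?C \<subseteq> A\<close> assms] by simp
qed

lemma commutator_in_lower_central:
  assumes "subgroup A G" "h \<in> lower_central (G\<lparr>carrier := A\<rparr>) i" "k \<in> A"
  shows "h \<otimes> k \<otimes> inv h \<otimes> inv k \<in> lower_central (G\<lparr>carrier := A\<rparr>) (Suc i)"
proof -
  have "h \<in> A" using lower_central_subgroup[OF assms(1)] assms(2) by blast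
  then have "inv\<^bsub>G\<lparr>carrier := A\<rparr>\<^esub> h = inv h" "inv\<^bsub>G\<lparr>carrier := A\<rparr>\<^esub> k = inv k"
    using m_inv_consistent[OF assms(1)] assms(3) by auto
  then have "h \<otimes> k \<otimes> inv h \<otimes> inv k =
      h \<otimes> k \<otimes> inv\<^bsub>G\<lparr>carrier := A\<rparr>\<^esub> h \<otimes> inv\<^bsub>G\<lparr>carrier := A\<rparr>\<^esub> k" by simp
  then show ?thesis
    using assms(2,3) unfolding lower_central.simps commutator_subgroup_def
    by (intro generate.incl UN_I) simp_all
qed

text \<open>The last term of the lower central series of \<open>A\<close> not contained in \<open>M\<close> normalizes
  \<open>M \<inter> A\<close>, so the normalizer of \<open>M \<inter> A\<close> is strictly larger than \<open>M\<close>.\<close>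

lemma maximal_subgroup_Int_nilpotent_normal:
  assumes A: "A \<lhd> G" "nilpotent_group (G\<lparr>carrier := A\<rparr>)" and M: "maximal_subgroup M G"
  shows "M \<inter> A \<lhd> G"
proof (cases "A \<subseteq> M")
  case True
  then show ?thesis using A(1) by (simp add: Int_absorb1)
next
  case False
  interpret A: normal A G by fact
  have subA: "subgroup A G" by (rule A.subgroup_axioms)
  have subM: "subgroup M G" using M unfolding maximal_subgroup_def by blast
  let ?\<gamma> = "lower_central (G\<lparr>carrier := A\<rparr>)"
  obtain n where n: "?\<gamma> n = {\<one>}" using A(2) unfolding nilpotent_group_def by auto
  \<comment> \<open>The series starts with \<open>A\<close>, which is not inside \<open>M\<close>,
    and reaches the trivial group, so it enters \<open>M\<close> at some step.\<close>
  obtain i where i: "\<not> ?\<gamma> i \<subseteq> M" "?\<gamma> (Suc i) \<subseteq> M"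
  proof -
    have "?\<gamma> n \<subseteq> M" using n subgroup.one_closed[OF subM] by simp
    moreover have "\<not> ?\<gamma> 0 \<subseteq> M" using False by simp
    ultimately have "\<exists>i. \<not> ?\<gamma> i \<subseteq> M \<and> ?\<gamma> (Suc i) \<subseteq> M"
      by (induction n) (blast, metis)
    then show thesis using that by blast
  qed
  obtain g where g: "g \<in> ?\<gamma> i" "g \<notin> M" using i(1) by blast
  let ?R = "M \<inter> A"
  \<comment> \<open>The normalizer of \<open>?R\<close>. Demanding both conjugations makes closure
    under inverses immediate; the price is that the element \<open>g\<close> found above must be
    treated together with \<open>inv g\<close>.\<close>
  let ?N = "{g \<in> carrier G. \<forall>r\<in>?R. g \<otimes> r \<otimes> inv g \<in> ?R \<and> inv g \<otimes> r \<otimes> g \<in> ?R}"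
  have RG: "r \<in> carrier G" if "r \<in> ?R" for r using that A.subset by blast
  have subN: "subgroup ?N G"
  proof (rule subgroupI)
    show "?N \<subseteq> carrier G" by blast
    have "\<one> \<in> ?N" using RG by simp
    then show "?N \<noteq> {}" by blast
    show "inv a \<in> ?N" if "a \<in> ?N" for a using that by simp
    show "a \<otimes> b \<in> ?N" if ab: "a \<in> ?N" "b \<in> ?N" for a b
    proof -
      have abG: "a \<in> carrier G" "b \<in> carrier G" using ab by auto
      have "a \<otimes> b \<otimes> r \<otimes> inv (a \<otimes> b) \<in> ?R \<and> inv (a \<otimes> b) \<otimes> r \<otimes> (a \<otimes> b) \<in> ?R" if r: "r \<in> ?R" for r
      proof -
        have "a \<otimes> (b \<otimes> r \<otimes> inv b) \<otimes> inv a \<in> ?R" "inv b \<otimes> (inv a \<otimes> r \<otimes> a) \<otimes> b \<in> ?R"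
          using ab r by blast+
        then show ?thesis using abG RG[OF r] by (simp add: m_assoc inv_mult_group)
      qed
      then show ?thesis using abG by blast
    qed
  qed
  have MN: "M \<subseteq> ?N"
  proof
    fix m assume m: "m \<in> M"
    then have mG: "m \<in> carrier G" using subgroup.subset[OF subM] by blast
    have "m \<otimes> r \<otimes> inv m \<in> ?R \<and> inv m \<otimes> r \<otimes> m \<in> ?R" if "r \<in> ?R" for r
      using that m mG A.inv_op_closed1[OF mG] A.inv_op_closed2[OF mG]
        subgroup.m_closed[OF subM] subgroup.m_inv_closed[OF subM] by simp
    then show "m \<in> ?N" using mG by blast
  qed
  \<comment> \<open>The commutator of \<open>h\<close> and \<open>r\<close> lies in the next term of
    the series, hence in \<open>M\<close>; multiplying by \<open>r\<close> gives the
    conjugate.\<close>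
  have conj: "h \<otimes> r \<otimes> inv h \<in> ?R" if h: "h \<in> ?\<gamma> i" and r: "r \<in> ?R" for h r
  proof -
    have hA: "h \<in> A" using lower_central_subgroup[OF subA] h by blast
    have "h \<otimes> r \<otimes> inv h \<otimes> inv r \<in> M"
      using commutator_in_lower_central[OF subA h] r i(2) by blast
    then have "h \<otimes> r \<otimes> inv h \<otimes> inv r \<otimes> r \<in> M" using r subgroup.m_closed[OF subM] by blast
    then have "h \<otimes> r \<otimes> inv h \<in> M" using hA A.subset RG[OF r] by (simp add: m_assoc subset_iff)
    moreover have "h \<otimes> r \<otimes> inv h \<in> A"
      using hA r A.m_closed A.m_inv_closed by simp
    ultimately show ?thesis by simp
  qed
  have gA: "g \<in> A" using lower_central_subgroup[OF subA] g(1) by blast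
  then have gG: "g \<in> carrier G" using A.subset by blast
  have "subgroup (?\<gamma> i) G" using lower_central_subgroup[OF subA] by simp
  then have "inv g \<in> ?\<gamma> i" using g(1) by (rule subgroup.m_inv_closed)
  then have "g \<in> ?N" using conj[OF g(1)] conj[of "inv g"] gG by simp
  then have "?N \<noteq> M" using g(2) by blast
  then have "?N = carrier G" using M subN MN unfolding maximal_subgroup_def by blast
  then show ?thesis
    using normal_invI[OF subgroups_Inter_pair[OF subM subA]] by blast
qed

text \<open>By maximality \<open>M\<close> and \<open>T\<close> generate G, and normality of
  \<open>T\<close> turns this into G = MT.\<close>

lemma maximal_subgroup_normal_factorE:
  assumes M: "maximal_subgroup M G" and T: "T \<lhd> G" "\<not> T \<subseteq> M" and g: "g \<in> carrier G"
  obtains m t where "m \<in> M" "t \<in> T" "g = m \<otimes> t"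
proof -
  have subM: "subgroup M G" using M unfolding maximal_subgroup_def by blast
  let ?K = "generate G (M \<union> T)"
  have "subgroup ?K G"
    using subgroup.subset[OF subM] normal_imp_subgroup[OF T(1)] subgroup.subset
    by (intro generate_is_subgroup) blast
  moreover have "M \<union> T \<subseteq> ?K" by (auto intro: generate.incl)
  ultimately have "?K = carrier G" using M T(2) unfolding maximal_subgroup_def by blast
  then show thesis using generate_Un_normalE[OF subM T(1)] g that by blast
qed

subsection \<open>From maximal subgroups to generators\<close>

lemma general_position_card_le_m_irr:
  assumes fin: "finite (carrier G)" and nil: "nilpotent_group (G\<lparr>carrier := derived G (carrier G)\<rparr>)"
    and max: "\<And>i. i \<in> I \<Longrightarrow> maximal_subgroup (M i) G" and gp: "general_position G I M"
    and finI: "finite I"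
  shows "card I \<le> m_irr G"
proof -
  let ?A = "derived G (carrier G)"
  let ?c = gen_mod_derived
  have nA: "?A \<lhd> G" by (rule derived_self_is_normal)
  have subA: "subgroup ?A G" using normal_imp_subgroup[OF nA] .
  have AG: "?A \<subseteq> carrier G" using subgroup.subset[OF subA] .
  have subM: "subgroup (M i) G" and neM: "M i \<noteq> carrier G" if "i \<in> I" for i
    using max[OF that] unfolding maximal_subgroup_def by auto
  \<comment> \<open>The subgroups R and C of the overview are \<open>D J\<close> and
    \<open>C J\<close>. Intersecting with \<open>?A\<close> or the carrier gives the right value for
    empty \<open>K\<close>: \<open>D {}\<close> is \<open>?A\<close> and \<open>C {}\<close> is
    G.\<close>
  define D where "D K = ?A \<inter> (\<Inter>j\<in>K. M j)" for K
  define C where "C K = carrier G \<inter> (\<Inter>j\<in>K. M j)" for K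
  have DX: "D K = ?A \<inter> C K" for K unfolding D_def C_def using AG by blast
  have D_insert: "D (insert j K) = (M j \<inter> ?A) \<inter> D K" for j K unfolding D_def by blast
  have D_mono: "D L \<subseteq> D K" if "K \<subseteq> L" for K L unfolding D_def using that by blast
  have nD: "D K \<lhd> G" if "K \<subseteq> I" for K
  proof -
    have "finite K" using that finI finite_subset by blast
    then show ?thesis using that
    proof (induction K)
      case empty
      then show ?case using nA by (simp add: D_def)
    next
      case (insert j K)
      then have "M j \<inter> ?A \<lhd> G" "D K \<lhd> G"
        using maximal_subgroup_Int_nilpotent_normal[OF nA nil max] by auto
      then show ?case unfolding D_insert by (rule normal_subgroup_intersect)
    qed
  qed
  have subX: "subgroup (C K) G" if "K \<subseteq> I" for K
  proof -
    have "subgroup (\<Inter>(insert (carrier G) (M ` K))) G"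
      using that subM subgroup_self by (intro subgroups_Inter) auto
    then show ?thesis unfolding C_def by simp
  qed

  \<comment> \<open>\<open>D J = D I\<close> says that the \<open>M i\<close> with \<open>i\<close>
    outside \<open>J\<close> cut off nothing more inside \<open>?A\<close>; minimality of
    \<open>J\<close> supplies the elements \<open>a i\<close>.\<close>
  obtain J where J: "J \<subseteq> I" "D J = D I" and Jmin: "\<And>K. K \<subset> J \<Longrightarrow> D K \<noteq> D I"
  proof -
    let ?F = "{K. K \<subseteq> I \<and> D K = D I}"
    have "finite ?F" using finI by simp
    then obtain J where "J \<in> ?F" "\<forall>K\<in>?F. K \<subseteq> J \<longrightarrow> J = K"
      using finite_has_minimal2[of ?F I] by auto
    then show thesis by (intro that[of J]) auto
  qed
  have finJ: "finite J" using J(1) finI finite_subset by blast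
  have "\<forall>i. \<exists>x. i \<in> J \<longrightarrow> x \<in> D (J - {i}) \<and> x \<notin> M i"
  proof (intro allI)
    fix i
    show "\<exists>x. i \<in> J \<longrightarrow> x \<in> D (J - {i}) \<and> x \<notin> M i"
    proof (cases "i \<in> J")
      case True
      then have "D (J - {i}) \<noteq> D J" using Jmin[of "J - {i}"] J(2) by auto
      moreover have "D J = M i \<inter> D (J - {i})" unfolding D_def using True by blast
      ultimately show ?thesis by blast
    qed simp
  qed
  then obtain a where a: "\<And>i. i \<in> J \<Longrightarrow> a i \<in> D (J - {i})" and aM: "\<And>i. i \<in> J \<Longrightarrow> a i \<notin> M i"
    unfolding choice_iff by blast
  have aA: "a i \<in> ?A" if "i \<in> J" for i using a[OF that] unfolding D_def by blast

  \<comment> \<open>Enlarging \<open>K\<close> by \<open>j\<close>: the normal subgroup \<open>D K\<close> contains \<open>a j\<close>, so \<open>M j\<close> supplements it.\<close>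
  have XA: "\<exists>x\<in>C K. \<exists>b\<in>?A. g = x \<otimes> b" if "K \<subseteq> J" "g \<in> carrier G" for K g
  proof -
    have "finite K" using that(1) finJ finite_subset by blast
    then show ?thesis using that(1)
    proof (induction K)
      case empty
      then show ?case using that(2) subgroup.one_closed[OF subA] by (intro bexI[of _ g] bexI[of _ \<one>])
          (auto simp: C_def)
    next
      case (insert j K)
      then obtain x b where x: "x \<in> C K" "b \<in> ?A" "g = x \<otimes> b" by blast
      have jJ: "j \<in> J" and KI: "K \<subseteq> I" using insert J(1) by auto
      have "a j \<in> D K" using a[OF jJ] D_mono[of K "J - {j}"] insert by blast
      then have "\<not> D K \<subseteq> M j" using aM[OF jJ] by blast
      moreover have xG: "x \<in> carrier G" using x(1) unfolding C_def by blast
      ultimately obtain m t where m: "m \<in> M j" "t \<in> D K" "x = m \<otimes> t"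
        using maximal_subgroup_normal_factorE[OF max nD[OF KI]] jJ J(1) by blast
      have tX: "t \<in> C K" "t \<in> ?A" using m(2) unfolding DX by auto
      have tG: "t \<in> carrier G" and mG: "m \<in> carrier G" and bG: "b \<in> carrier G"
        using tX(2) AG m(1) subgroup.subset[OF subM] jJ J(1) x(2) by auto
      have "x \<otimes> inv t \<in> C K"
        using subgroup.m_closed[OF subX[OF KI] x(1) subgroup.m_inv_closed[OF subX[OF KI] tX(1)]] .
      also have "x \<otimes> inv t = m" using m(3) mG tG by (simp add: m_assoc)
      finally have "m \<in> C (insert j K)" using m(1) unfolding C_def by blast
      moreover have "t \<otimes> b \<in> ?A" using subgroup.m_closed[OF subA tX(2) x(2)] .
      moreover have "g = m \<otimes> (t \<otimes> b)" using x(3) m(3) mG tG bG by (simp add: m_assoc)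
      ultimately show ?case by blast
    qed
  qed
  have XJ: "C J \<subseteq> carrier G" unfolding C_def by blast
  have genX: "?c (C J) = carrier G"
  proof
    show "?c (C J) \<subseteq> carrier G" using subgroup.subset[OF gen_mod_derived_subgroup[OF XJ]] .
    show "carrier G \<subseteq> ?c (C J)"
    proof
      fix g assume "g \<in> carrier G"
      then obtain x b where "x \<in> C J" "b \<in> ?A" "g = x \<otimes> b" using XA[of J] by blast
      then show "g \<in> ?c (C J)"
        using subgroup.m_closed[OF gen_mod_derived_subgroup[OF XJ]] gen_mod_derived_incl[of "C J"] by blast
    qed
  qed

  have "\<forall>i. \<exists>x. i \<in> I \<longrightarrow> x \<in> C (I - {i}) \<and> x \<notin> M i"
  proof (intro allI)
    fix i
    show "\<exists>x. i \<in> I \<longrightarrow> x \<in> C (I - {i}) \<and> x \<notin> M i"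
    proof (cases "i \<in> I")
      case True
      have "C I \<subset> C (I - {i})"
        using bspec[OF gp[unfolded general_position_def] True] unfolding C_def .
      moreover have "C I = M i \<inter> C (I - {i})" unfolding C_def using True by blast
      ultimately show ?thesis by blast
    qed simp
  qed
  then obtain z where z: "\<And>i. i \<in> I \<Longrightarrow> z i \<in> C (I - {i})" and zM: "\<And>i. i \<in> I \<Longrightarrow> z i \<notin> M i"
    unfolding choice_iff by blast
  have z': "z i \<in> M j" if "i \<in> I" "j \<in> I" "i \<noteq> j" for i j
    using z[OF that(1)] that unfolding C_def by blast
  have inj_z: "inj_on z I" using z' zM by (intro inj_onI) metis
  let ?Z = "z ` (I - J)"
  have ZX: "?Z \<subseteq> C J"
  proof
    fix x assume "x \<in> ?Z"
    then obtain i where i: "i \<in> I" "i \<notin> J" "x = z i" by blast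
    have "C (I - {i}) \<subseteq> C J" using J(1) i(2) unfolding C_def by blast
    then show "x \<in> C J" using z[OF i(1)] i(3) by blast
  qed
  have irrZ: "irredundant_mod_derived ?Z"
    unfolding irredundant_mod_derived_def
  proof
    fix x assume "x \<in> ?Z"
    then obtain i where i: "i \<in> I" "i \<notin> J" "x = z i" by blast
    \<comment> \<open>\<open>?U\<close> contains all the other \<open>z j\<close>. If
      \<open>z i\<close> were \<open>u \<otimes> b\<close> with \<open>u\<close> in
      \<open>?U\<close> and \<open>b\<close> in \<open>?A\<close>, then \<open>b\<close> would lie
      in \<open>D J = D I\<close>, hence in \<open>M i\<close>, and so would
      \<open>z i\<close>.\<close>
    let ?U = "C J \<inter> M i"
    have subU: "subgroup ?U G" using subgroups_Inter_pair[OF subX[OF J(1)] subM[OF i(1)]] .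
    have "?Z - {x} \<subseteq> ?U" using ZX z' i by auto
    then have le: "?c (?Z - {x}) \<subseteq> generate G (?U \<union> ?A)"
      unfolding gen_mod_derived_def by (intro mono_generate) blast
    show "x \<notin> ?c (?Z - {x})"
    proof
      assume "x \<in> ?c (?Z - {x})"
      then obtain u b where u: "u \<in> ?U" "b \<in> ?A" "x = u \<otimes> b"
        using generate_Un_normalE[OF subU nA] le by blast
      have xX: "x \<in> C J" using ZX \<open>x \<in> ?Z\<close> by blast
      have uX: "u \<in> C J" using u(1) by blast
      have "inv u \<otimes> x \<in> C J"
        using subgroup.m_closed[OF subX[OF J(1)] subgroup.m_inv_closed[OF subX[OF J(1)] uX] xX] .
      also have "inv u \<otimes> x = b" using u(2,3) uX XJ AG by (simp add: subset_iff m_assoc[symmetric])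
      finally have "b \<in> D J" using u(2) unfolding DX by blast
      then have "b \<in> M i" using J(2) i(1) unfolding D_def by blast
      then have "x \<in> M i" using u subgroup.m_closed[OF subM[OF i(1)]] by blast
      then show False using zM i by blast
    qed
  qed
  \<comment> \<open>Staying inside \<open>C J\<close> keeps \<open>Y\<close> in every
    \<open>M i\<close> with \<open>i\<close> in \<open>J\<close>; this is what later makes the
    \<open>a i\<close> irredundant.\<close>
  obtain Y where Y: "Y \<subseteq> C J" "irredundant_mod_derived Y" "card ?Z \<le> card Y" "?c Y = carrier G"
    using irredundant_mod_derived_extend[OF fin subX[OF J(1)] genX ZX irrZ] .

  let ?W = "Y \<union> a ` J"
  have aM': "a i \<in> M j" if "i \<in> J" "j \<in> J" "i \<noteq> j" for i j
    using a[OF that(1)] that unfolding D_def by blast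
  have inj_a: "inj_on a J" using aM' aM by (intro inj_onI) metis
  have disj: "Y \<inter> a ` J = {}"
  proof -
    have "y \<notin> ?A" if "y \<in> Y" for y
      using that Y(2) gen_mod_derived_incl unfolding irredundant_mod_derived_def by blast
    then show ?thesis using aA by blast
  qed
  have YG: "Y \<subseteq> carrier G" using Y(1) XJ by blast
  have WG: "?W \<subseteq> carrier G" using YG aA AG by blast
  have finY: "finite Y" using YG fin finite_subset by blast
  have DG: "D J \<subseteq> carrier G" using AG unfolding D_def by blast
  \<comment> \<open>Otherwise a maximal subgroup \<open>P\<close> contains all these elements.
    Removing indices from \<open>J\<close> one at a time shows that \<open>P\<close> contains ever
    larger \<open>D (J - K)\<close>, finally \<open>D {}\<close>, which is \<open>?A\<close>; but
    \<open>Y\<close> and \<open>?A\<close> generate G.\<close>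
  have gen: "generate G (?W \<union> D J) = carrier G"
  proof (rule ccontr)
    assume "generate G (?W \<union> D J) \<noteq> carrier G"
    moreover have "subgroup (generate G (?W \<union> D J)) G" using WG DG by (intro generate_is_subgroup) simp
    ultimately obtain P where P: "maximal_subgroup P G" and "generate G (?W \<union> D J) \<subseteq> P"
      using maximal_subgroup_exists[OF fin] by metis
    then have WP: "?W \<subseteq> P" "D J \<subseteq> P" using generate.incl[of _ "?W \<union> D J" G] by auto
    have subP: "subgroup P G" and neP: "P \<noteq> carrier G" using P unfolding maximal_subgroup_def by auto
    have DP: "D (J - K) \<subseteq> P" if "K \<subseteq> J" for K
    proof -
      have "finite K" using that finJ finite_subset by blast
      then show ?thesis using that
      proof (induction K)
        case empty
        then show ?case using WP(2) by simp
      next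
        case (insert j K)
        let ?L = "J - insert j K"
        have jJ: "j \<in> J" and jI: "j \<in> I" and LI: "?L \<subseteq> I" using insert J(1) by auto
        have eq: "J - K = insert j ?L" using insert by auto
        have IH: "D (insert j ?L) \<subseteq> P" using insert eq by auto
        show ?case
        proof
          fix r assume r: "r \<in> D ?L"
          \<comment> \<open>By nilpotence of \<open>?A\<close>, \<open>?T\<close> is normal, and it
            contains \<open>a j\<close>, so \<open>M j\<close> supplements it. In
            \<open>r = s \<otimes> t\<close> the factor \<open>t\<close> is in \<open>P\<close> by
            choice of \<open>?T\<close>, and \<open>s\<close> is in \<open>D (insert j ?L)\<close>,
            hence in \<open>P\<close> by induction.\<close>
          let ?T = "(P \<inter> ?A) \<inter> D ?L"
          have nT: "?T \<lhd> G"
            by (rule normal_subgroup_intersect[OF maximal_subgroup_Int_nilpotent_normal[OF nA nil P] nD[OF LI]])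
          have "a j \<in> ?T"
            using aA[OF jJ] WP(1) jJ a[OF jJ] D_mono[of ?L "J - {j}"] by blast
          then have "\<not> ?T \<subseteq> M j" using aM[OF jJ] by blast
          moreover have rA: "r \<in> ?A" using r unfolding D_def by blast
          ultimately obtain s t where s: "s \<in> M j" "t \<in> ?T" "r = s \<otimes> t"
            using maximal_subgroup_normal_factorE[OF max[OF jI] nT] AG by blast
          have tG: "t \<in> carrier G" and sG: "s \<in> carrier G"
            using s(1,2) AG subgroup.subset[OF subM[OF jI]] by auto
          have subD: "subgroup (D ?L) G" using normal_imp_subgroup[OF nD[OF LI]] .
          have "r \<otimes> inv t \<in> D ?L"
            using subgroup.m_closed[OF subD r] subgroup.m_inv_closed[OF subD] s(2) by simp
          also have "r \<otimes> inv t = s" using s(3) sG tG by (simp add: m_assoc)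
          finally have "s \<in> D (insert j ?L)" using s(1) unfolding D_def by blast
          then have "s \<in> P" using IH by blast
          moreover have "t \<in> P" using s(2) by blast
          ultimately show "r \<in> P" using s(3) subgroup.m_closed[OF subP] by blast
        qed
      qed
    qed
    have "?A \<subseteq> P" using DP[of J] unfolding D_def by simp
    then have "?c Y \<subseteq> P" using gen_mod_derived_least[OF subP] WP(1) by blast
    then show False using Y(4) neP subgroup.subset[OF subP] by blast
  qed
  \<comment> \<open>For \<open>w\<close> in \<open>Y\<close>, everything outside \<open>Y\<close>
    lies in \<open>?A\<close>, so irredundance modulo \<open>?A\<close> applies. For
    \<open>w = a i\<close>, all remaining elements lie in the proper subgroup
    \<open>M i\<close>.\<close>
  have ind: "generate G (?W - {w} \<union> D J) \<noteq> carrier G" if "w \<in> ?W" for w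
  proof (cases "w \<in> Y")
    case True
    have "?W - {w} \<union> D J \<subseteq> Y - {w} \<union> ?A" using aA unfolding D_def by blast
    then have "generate G (?W - {w} \<union> D J) \<subseteq> ?c (Y - {w})"
      unfolding gen_mod_derived_def by (rule mono_generate)
    moreover have "w \<notin> ?c (Y - {w})" using Y(2) True unfolding irredundant_mod_derived_def by blast
    ultimately show ?thesis using YG True by blast
  next
    case False
    then have "w \<in> a ` J" using \<open>w \<in> ?W\<close> by blast
    then obtain i where i: "i \<in> J" "w = a i" by blast
    have "i \<in> I" using i(1) J(1) by blast
    have "Y \<subseteq> M i" "D J \<subseteq> M i" using Y(1) i(1) unfolding C_def D_def by blast+
    moreover have "a ` J - {w} \<subseteq> M i" using aM' i by auto
    ultimately have "generate G (?W - {w} \<union> D J) \<subseteq> M i"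
      by (intro generate_subgroup_incl[OF _ subM[OF \<open>i \<in> I\<close>]]) blast
    then show ?thesis using neM[OF \<open>i \<in> I\<close>] subgroup.subset[OF subM[OF \<open>i \<in> I\<close>]] by blast
  qed
  have "card I = card (I - J) + card J" using J(1) finI card_Diff_subset[OF finJ] card_mono[OF finI] by simp
  also have "\<dots> \<le> card Y + card (a ` J)"
    using Y(3) card_image[OF inj_on_subset[OF inj_z Diff_subset]] card_image[OF inj_a] by simp
  also have "\<dots> = card ?W" using card_Un_disjoint[OF finY _ disj] finJ by simp
  also have "\<dots> \<le> m_irr G" using le_m_irr[OF fin WG DG gen ind] .
  finally show ?thesis .
qed

end

section \<open>Equality of the two maxima\<close>

theorem theorem1:
  fixes G :: "('a, 'b) monoid_scheme"
  assumes "group G"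
    and "finite (carrier G)"
    and "nilpotent_group (G\<lparr>carrier := derived G (carrier G)\<rparr>)"
  shows "max_dim G = m_irr G"
proof (rule antisym)
  interpret group G by fact
  show "m_irr G \<le> max_dim G" using m_irr_le_max_dim[OF assms(2)] .
  let ?S = "{n. \<exists>H :: nat \<Rightarrow> 'a set. (\<forall>i<n. maximal_subgroup (H i) G) \<and> general_position G {..<n} H}"
  \<comment> \<open>The empty family makes the set nonempty, so the maximum is attained by an actual
    family.\<close>
  have "0 \<in> ?S" by (simp add: general_position_def)
  then have "?S \<noteq> {}" by blast
  then have "max_dim G \<in> ?S"
    unfolding max_dim_def using finite_general_position_sizes[OF assms(2)] by (intro Max_in)
  then obtain H :: "nat \<Rightarrow> 'a set" where
    "\<forall>i<max_dim G. maximal_subgroup (H i) G" "general_position G {..<max_dim G} H" by blast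
  then show "max_dim G \<le> m_irr G"
    using general_position_card_le_m_irr[OF assms(2,3), of "{..<max_dim G}" H] by simp
qed

end
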